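(* Let $G$ be a graph on $n \geq 3$ vertices with edge density $\varepsilon$, triangle density $\tau$, and clique-number density $\kappa$. If $G$ is $C_4$-free, then $$\tau \;\geq\; \max\left\{\, \varepsilon^{2}-\frac{(1-\varepsilon)(\kappa n+\varepsilon)}{n-2},\;\; 1-\tfrac{3}{2}(1-\varepsilon)\left(1+\frac{\kappa n}{n-2}\right)\right\}.$$
   Context: Graphs are finite and simple. A graph is $C_4$-free if it has no induced subgraph isomorphic to the cycle on four vertices. For a graph $G=(V,E)$ on $n$ vertices: the edge density is $\varepsilon = |E|/\binom{n}{2}$; the triangle density is $\tau = (\text{number of triangles in } G)/\binom{n}{3}$; the clique number $\omega(G)$ is the order of the largest complete subgraph of $G$; the clique-number density is $\kappa=\omega(G)/n$. *)

theory Defs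
  imports Complex_Main "HOL-Library.Ramsey"
begin

text \<open>A finite simple graph is a finite vertex set together with a set of unordered pairs of
  distinct vertices; \<open>[V]\<^bsup>k\<^esup>\<close> (\<^const>\<open>nsets\<close>) is the set of
  \<open>k\<close>-element subsets of \<open>V\<close>.\<close>

definition simple_graph :: "'a set \<Rightarrow> 'a set set \<Rightarrow> bool" where
  "simple_graph V E \<longleftrightarrow> finite V \<and> E \<subseteq> [V]\<^bsup>2\<^esup>"

definition induced_edges :: "'a set set \<Rightarrow> 'a set \<Rightarrow> 'a set set" where
  "induced_edges E S = {e \<in> E. e \<subseteq> S}"

definition graph_isomorphic ::
    "'a set \<Rightarrow> 'a set set \<Rightarrow> 'b set \<Rightarrow> 'b set set \<Rightarrow> bool" where
  "graph_isomorphic V E W F \<longleftrightarrow>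
     (\<exists>f. bij_betw f V W \<and> (\<forall>u\<in>V. \<forall>v\<in>V. {u, v} \<in> E \<longleftrightarrow> {f u, f v} \<in> F))"

definition cycle_edges :: "nat \<Rightarrow> nat set set" where
  "cycle_edges n = {{i, (i + 1) mod n} | i. i < n}"

definition C4_free :: "'a set \<Rightarrow> 'a set set \<Rightarrow> bool" where
  "C4_free V E \<longleftrightarrow>
     \<not> (\<exists>S \<subseteq> V. graph_isomorphic S (induced_edges E S) {..<4} (cycle_edges 4))"

definition triangles :: "'a set \<Rightarrow> 'a set set \<Rightarrow> 'a set set" where
  "triangles V E = {T \<in> [V]\<^bsup>3\<^esup>. clique T E}"

definition clique_number :: "'a set \<Rightarrow> 'a set set \<Rightarrow> nat" where
  "clique_number V E = Max (card ` {K. K \<subseteq> V \<and> clique K E})"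

definition edge_density :: "'a set \<Rightarrow> 'a set set \<Rightarrow> real" where
  "edge_density V E = real (card E) / real (card V choose 2)"

definition triangle_density :: "'a set \<Rightarrow> 'a set set \<Rightarrow> real" where
  "triangle_density V E = real (card (triangles V E)) / real (card V choose 3)"

definition clique_density :: "'a set \<Rightarrow> 'a set set \<Rightarrow> real" where
  "clique_density V E = real (clique_number V E) / real (card V)"

end

theory Submission
  imports Defs "HOL-Analysis.Convex"
begin

text \<open>In a \<open>C\<^sub>4\<close>-free graph the common neighbours of two non-adjacent vertices form a clique, so
  the number of induced paths on three vertices is at most \<open>\<omega>(G)\<close> times the number of
  non-edges. Counting all paths on three vertices by their middle vertex and applying Cauchy-Schwarz
  to the degree sequence gives the first bound. For the second, a triple that is not a triangle
  either contains two non-edges or induces a path; hence twice the number of non-triangles is at most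
  the number of incidences between non-edges and triples plus the number of induced paths. All
  counts are taken over ordered triples.\<close>

section \<open>Edges and triangles as ordered tuples\<close>

lemma card_ordered_pairs:
  assumes "finite V" "E \<subseteq> [V]\<^bsup>2\<^esup>"
  shows "card {(u, v) \<in> V \<times> V. {u, v} \<in> E} = 2 * card E"
proof -
  have finE: "finite E"
    using assms finite_imp_finite_nsets finite_subset by blast
  have fib: "card {(u, v). {u, v} = e} = 2 \<and> finite {(u, v). {u, v} = e}" if "e \<in> E" for e
  proof -
    have "card e = 2" using that assms(2) by (auto simp: nsets_def)
    then obtain x y where e: "e = {x, y}" "x \<noteq> y"
      by (auto simp: card_2_iff)
    have "{(u, v). {u, v} = e} = {(x, y), (y, x)}"
      using e by (auto simp: doubleton_eq_iff)
    then show ?thesis using e by simp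
  qed
  have "{(u, v) \<in> V \<times> V. {u, v} \<in> E} = (\<Union>e\<in>E. {(u, v). {u, v} = e})"
    using assms(2) by (auto simp: nsets_def)
  also have "card \<dots> = (\<Sum>e\<in>E. card {(u, v). {u, v} = e})"
    using finE fib by (intro card_UN_disjoint) auto
  also have "\<dots> = 2 * card E"
    using fib by simp
  finally show ?thesis .
qed

lemma card_ordered_triples:
  assumes "finite V" "T \<subseteq> [V]\<^bsup>3\<^esup>"
  shows "card {(u, v, w) \<in> V \<times> V \<times> V. {u, v, w} \<in> T} = 6 * card T"
proof -
  have finT: "finite T"
    using assms finite_imp_finite_nsets finite_subset by blast
  have fib: "card {(u, v, w). {u, v, w} = t} = 6 \<and> finite {(u, v, w). {u, v, w} = t}"
    if "t \<in> T" for t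
  proof -
    have "card t = 3" using that assms(2) by (auto simp: nsets_def)
    then obtain x y z where t: "t = {x, y, z}" "x \<noteq> y" "x \<noteq> z" "y \<noteq> z"
      by (auto simp: card_3_iff)
    have "{(u, v, w). {u, v, w} = t} =
        {(x, y, z), (x, z, y), (y, x, z), (y, z, x), (z, x, y), (z, y, x)}" (is "?L = ?R")
    proof
      show "?L \<subseteq> ?R"
      proof
        fix p assume "p \<in> ?L"
        then obtain u v w where p: "p = (u, v, w)" "{u, v, w} = t" by auto
        \<comment> \<open>Containment in both directions forces a permutation: the first three
          memberships leave 27 assignments, and the last three discard those that repeat a
          vertex.\<close>
        then have "u \<in> {x, y, z}" "v \<in> {x, y, z}" "w \<in> {x, y, z}"
            "x \<in> {u, v, w}" "y \<in> {u, v, w}" "z \<in> {u, v, w}"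
          unfolding t(1) by blast+
        then show "p \<in> ?R"
          unfolding p(1) insert_iff empty_iff Pair_inject using t(2-4) by metis
      qed
      show "?R \<subseteq> ?L" using t by auto
    qed
    then show ?thesis using t by simp
  qed
  \<comment> \<open>The fibres may drop the restriction to \<open>V\<close>, because every member of
    \<open>T\<close> is already a subset of \<open>V\<close>.\<close>
  have "{(u, v, w) \<in> V \<times> V \<times> V. {u, v, w} \<in> T} = (\<Union>t\<in>T. {(u, v, w). {u, v, w} = t})"
    using assms(2) by (auto simp: nsets_def)
  also have "card \<dots> = (\<Sum>t\<in>T. card {(u, v, w). {u, v, w} = t})"
    using finT fib by (intro card_UN_disjoint) auto
  also have "\<dots> = 6 * card T"
    using fib by simp
  finally show ?thesis .
qed

section \<open>Cliques and the induced four-cycle\<close>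

lemma clique_card_le_clique_number:
  assumes "finite V" "K \<subseteq> V" "clique K E"
  shows "card K \<le> clique_number V E"
  unfolding clique_number_def
proof (rule Max_ge)
  have "{K. K \<subseteq> V \<and> clique K E} \<subseteq> Pow V" by auto
  then show "finite (card ` {K. K \<subseteq> V \<and> clique K E})"
    using assms(1) by (meson finite_Pow_iff finite_imageI finite_subset)
qed (use assms in auto)

lemma cycle_edges_4: "cycle_edges 4 = {{0, 1}, {1, 2}, {2, 3}, {3, 0}}"
proof -
  have "cycle_edges 4 = (\<lambda>i. {i, (i + 1) mod 4}) ` {..<4}"
    unfolding cycle_edges_def by auto
  also have "{..<4} = {0, 1, 2, 3::nat}"
    by auto
  finally show ?thesis by (simp flip: numeral_2_eq_2)
qed

text \<open>Two non-adjacent common neighbours \<open>x\<close>, \<open>y\<close> of the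
  non-adjacent pair \<open>u\<close>, \<open>v\<close> would close up to the induced four-cycle
  u-x-v-y, whose two missing diagonals are uv and xy.\<close>

lemma C4_free_common_neighbours_clique:
  assumes "simple_graph V E" "C4_free V E" "u \<in> V" "v \<in> V" "u \<noteq> v" "{u, v} \<notin> E"
  shows "clique {w \<in> V. {u, w} \<in> E \<and> {v, w} \<in> E} E"
  unfolding clique_def
proof (intro ballI impI, rule ccontr)
  fix x y
  assume x: "x \<in> {w \<in> V. {u, w} \<in> E \<and> {v, w} \<in> E}"
    and y: "y \<in> {w \<in> V. {u, w} \<in> E \<and> {v, w} \<in> E}"
    and xy: "x \<noteq> y" "{x, y} \<notin> E"
  have loop: "{w} \<notin> E" for w
    using assms(1) by (auto simp: simple_graph_def nsets_def)
  have ne: "u \<noteq> x" "u \<noteq> y" "v \<noteq> x" "v \<noteq> y"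
    using x y loop by auto
  \<comment> \<open>The labels follow the cyclic order u, x, v, y, so that the two non-adjacent
    pairs receive the opposite labels 0, 2 and 1, 3.\<close>
  define f where "f = (\<lambda>w. if w = u then 0 else if w = x then 1 else if w = v then 2 else (3::nat))"
  have f: "f u = 0" "f x = 1" "f v = 2" "f y = 3"
    using ne xy assms(5) by (auto simp: f_def)
  have "bij_betw f {u, x, v, y} {..<4}"
  proof -
    have "{..<4} = {0, 1, 2, 3::nat}" by auto
    then show ?thesis
      unfolding bij_betw_def inj_on_def using f by auto
  qed
  moreover have "\<forall>a\<in>{u, x, v, y}. \<forall>b\<in>{u, x, v, y}.
      {a, b} \<in> induced_edges E {u, x, v, y} \<longleftrightarrow> {f a, f b} \<in> cycle_edges 4"
  proof -
    have "{u, x} \<in> E" "{v, x} \<in> E" "{u, y} \<in> E" "{v, y} \<in> E"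
      "{x, u} \<in> E" "{x, v} \<in> E" "{y, u} \<in> E" "{y, v} \<in> E"
      "{u, v} \<notin> E" "{v, u} \<notin> E" "{x, y} \<notin> E" "{y, x} \<notin> E"
      using x y xy(2) assms(6) by (simp_all add: insert_commute)
    then show ?thesis
      unfolding cycle_edges_4 induced_edges_def
      by (simp add: f doubleton_eq_iff loop)
  qed
  ultimately have "graph_isomorphic {u, x, v, y} (induced_edges E {u, x, v, y}) {..<4} (cycle_edges 4)"
    unfolding graph_isomorphic_def by blast
  moreover have "{u, x, v, y} \<subseteq> V" using assms x y by auto
  ultimately show False using assms(2) unfolding C4_free_def by blast
qed

section \<open>Indicator functions of edges and non-edges, and their sums\<close>

definition adj :: "'a set set \<Rightarrow> 'a \<Rightarrow> 'a \<Rightarrow> real" where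
  "adj E u v = of_bool ({u, v} \<in> E)"

text \<open>The indicator of the complement graph. Since the diagonal is excluded, it differs from 1
  - \<open>adj\<close>: in a simple graph both indicators vanish at u = v.\<close>

definition coadj :: "'a set set \<Rightarrow> 'a \<Rightarrow> 'a \<Rightarrow> real" where
  "coadj E u v = of_bool (u \<noteq> v \<and> {u, v} \<notin> E)"

lemma adj_commute: "adj E u v = adj E v u"
  by (simp add: adj_def insert_commute)

lemma adj_plus_coadj: "simple_graph V E \<Longrightarrow> adj E u v + coadj E u v = of_bool (u \<noteq> v)"
  by (auto simp: adj_def coadj_def simple_graph_def nsets_def)

lemma sum_adj:
  assumes "simple_graph V E"
  shows "(\<Sum>u\<in>V. \<Sum>v\<in>V. adj E u v) = 2 * real (card E)"
proof -
  have "finite V" using assms by (simp add: simple_graph_def)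
  then have "(\<Sum>u\<in>V. \<Sum>v\<in>V. adj E u v) = real (card {(u, v) \<in> V \<times> V. {u, v} \<in> E})"
  proof -
    have "(\<Sum>u\<in>V. \<Sum>v\<in>V. adj E u v) = (\<Sum>p\<in>V \<times> V. of_bool (p \<in> {(u, v). {u, v} \<in> E}))"
      by (simp only: adj_def sum.cartesian_product) (auto intro!: sum.cong)
    also have "\<dots> = real (card (V \<times> V \<inter> {(u, v). {u, v} \<in> E}))"
      using \<open>finite V\<close> by simp
    also have "V \<times> V \<inter> {(u, v). {u, v} \<in> E} = {(u, v) \<in> V \<times> V. {u, v} \<in> E}"
      by auto
    finally show ?thesis .
  qed
  then show ?thesis
    using card_ordered_pairs[of V E] assms by (simp add: simple_graph_def)
qed

lemma sum_distinct_right: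
  assumes "finite V" "u \<in> V"
  shows "(\<Sum>v\<in>V. of_bool (u \<noteq> v) :: real) = real (card V) - 1"
proof -
  have "V \<inter> {v. u \<noteq> v} = V - {u}" by auto
  moreover have "card V > 0" using assms card_gt_0_iff by blast
  ultimately show ?thesis
    using assms by (simp add: sum_of_bool_eq card_Diff_singleton of_nat_diff)
qed

lemma sum_coadj:
  assumes "simple_graph V E"
  shows "(\<Sum>u\<in>V. \<Sum>v\<in>V. coadj E u v) = real (card V) * (real (card V) - 1) - 2 * real (card E)"
proof -
  have "finite V" using assms by (simp add: simple_graph_def)
  have "(\<Sum>u\<in>V. \<Sum>v\<in>V. adj E u v) + (\<Sum>u\<in>V. \<Sum>v\<in>V. coadj E u v) =
      (\<Sum>u\<in>V. \<Sum>v\<in>V. of_bool (u \<noteq> v))"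
    by (simp add: sum.distrib[symmetric] adj_plus_coadj[OF assms])
  also have "\<dots> = real (card V) * (real (card V) - 1)"
    using \<open>finite V\<close> by (simp add: sum_distinct_right del: sum_of_bool_eq)
  finally show ?thesis using sum_adj[OF assms] by simp
qed

text \<open>Triples with a repeated vertex contribute nothing because no singleton is an edge, and
  each triangle is met once in each of its six orderings.\<close>

lemma sum_triangles:
  assumes "simple_graph V E"
  shows "(\<Sum>u\<in>V. \<Sum>v\<in>V. \<Sum>w\<in>V. adj E u v * adj E u w * adj E v w) = 6 * real (card (triangles V E))"
proof -
  have fin: "finite V" and loop: "\<And>w. {w} \<notin> E"
    using assms by (auto simp: simple_graph_def nsets_def)
  have tri: "{u, v, w} \<in> triangles V E \<longleftrightarrow> {u, v} \<in> E \<and> {u, w} \<in> E \<and> {v, w} \<in> E"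
    if "u \<in> V" "v \<in> V" "w \<in> V" for u v w
  proof
    assume L: "{u, v, w} \<in> triangles V E"
    then have "card {u, v, w} = 3" by (simp add: triangles_def nsets_def)
    then have "u \<noteq> v" "u \<noteq> w" "v \<noteq> w" by (auto simp: card_insert_if split: if_splits)
    with L show "{u, v} \<in> E \<and> {u, w} \<in> E \<and> {v, w} \<in> E"
      by (auto simp: triangles_def clique_def)
  next
    assume R: "{u, v} \<in> E \<and> {u, w} \<in> E \<and> {v, w} \<in> E"
    then have "u \<noteq> v" "u \<noteq> w" "v \<noteq> w" using loop by auto
    with R that show "{u, v, w} \<in> triangles V E"
      by (auto simp: triangles_def clique_def nsets_def insert_commute)
  qed
  have "(\<Sum>u\<in>V. \<Sum>v\<in>V. \<Sum>w\<in>V. adj E u v * adj E u w * adj E v w) =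
      (\<Sum>u\<in>V. \<Sum>v\<in>V. \<Sum>w\<in>V. of_bool ({u, v, w} \<in> triangles V E))"
    by (intro sum.cong refl) (simp add: tri adj_def)
  also have "\<dots> = (\<Sum>p\<in>V \<times> V \<times> V. of_bool (p \<in> {(u, v, w). {u, v, w} \<in> triangles V E}))"
    by (simp only: sum.cartesian_product) (auto intro!: sum.cong)
  also have "\<dots> = real (card (V \<times> V \<times> V \<inter> {(u, v, w). {u, v, w} \<in> triangles V E}))"
    using fin by simp
  also have "V \<times> V \<times> V \<inter> {(u, v, w). {u, v, w} \<in> triangles V E} =
      {(u, v, w) \<in> V \<times> V \<times> V. {u, v, w} \<in> triangles V E}"
    by auto
  finally show ?thesis
    using card_ordered_triples[OF fin, of "triangles V E"] by (auto simp: triangles_def)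
qed

section \<open>Paths on three vertices and the first bound\<close>

lemma sum_induced_paths_le:
  assumes "simple_graph V E" "C4_free V E"
  shows "(\<Sum>u\<in>V. \<Sum>v\<in>V. \<Sum>w\<in>V. coadj E u v * adj E u w * adj E v w) \<le>
    real (clique_number V E) * (\<Sum>u\<in>V. \<Sum>v\<in>V. coadj E u v)"
proof -
  have fin: "finite V" using assms by (simp add: simple_graph_def)
  have "(\<Sum>w\<in>V. coadj E u v * adj E u w * adj E v w) \<le> real (clique_number V E) * coadj E u v"
    if "u \<in> V" "v \<in> V" for u v
  proof (cases "u \<noteq> v \<and> {u, v} \<notin> E")
    case True
    have "(\<Sum>w\<in>V. coadj E u v * adj E u w * adj E v w) =
        (\<Sum>w\<in>V. of_bool ({u, w} \<in> E \<and> {v, w} \<in> E))"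
      using True by (intro sum.cong) (auto simp: coadj_def adj_def)
    also have "\<dots> = real (card {w \<in> V. {u, w} \<in> E \<and> {v, w} \<in> E})"
      using fin by (simp add: sum_of_bool_eq Int_def)
    \<comment> \<open>This is where C4-freeness enters: the common neighbours of a non-adjacent pair
      form a clique.\<close>
    also have "\<dots> \<le> real (clique_number V E)"
      using clique_card_le_clique_number[OF fin] True that
        C4_free_common_neighbours_clique[OF assms] by simp
    finally show ?thesis using True by (simp add: coadj_def)
  qed (auto simp: coadj_def)
  then show ?thesis
    by (simp add: sum_distrib_left sum_mono)
qed

text \<open>The triple sum counts walks u-w-v with u = v allowed; keeping these degenerate walks
  makes it exactly the sum of the squared degrees, to which Cauchy-Schwarz applies.\<close>

lemma sum_paths_ge:
  assumes "simple_graph V E"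
  shows "(2 * real (card E))\<^sup>2 \<le>
    real (card V) * (\<Sum>u\<in>V. \<Sum>v\<in>V. \<Sum>w\<in>V. adj E u w * adj E v w)"
proof -
  define d where "d w = (\<Sum>u\<in>V. adj E u w)" for w
  have "2 * real (card E) = (\<Sum>w\<in>V. d w)"
    unfolding d_def sum_adj[OF assms, symmetric] by (rule sum.swap)
  then have "(2 * real (card E))\<^sup>2 = (\<Sum>w\<in>V. d w)\<^sup>2" by simp
  also have "\<dots> \<le> real (card V) * (\<Sum>w\<in>V. (d w)\<^sup>2)"
    using sum_squared_le_sum_of_squares[of d V] by (simp add: mult.commute)
  also have "(\<Sum>w\<in>V. (d w)\<^sup>2) = (\<Sum>w\<in>V. \<Sum>u\<in>V. \<Sum>v\<in>V. adj E u w * adj E v w)"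
    by (simp add: d_def power2_eq_square sum_product)
  also have "\<dots> = (\<Sum>u\<in>V. \<Sum>w\<in>V. \<Sum>v\<in>V. adj E u w * adj E v w)"
    by (rule sum.swap)
  also have "\<dots> = (\<Sum>u\<in>V. \<Sum>v\<in>V. \<Sum>w\<in>V. adj E u w * adj E v w)"
    by (intro sum.cong refl sum.swap)
  finally show ?thesis .
qed

text \<open>Walks u-w-v are sorted by their ends: equal ends give the ordered edges, adjacent ends
  the ordered triangles, and distinct non-adjacent ends the induced paths.\<close>

lemma sum_paths_eq:
  assumes "simple_graph V E"
  shows "(\<Sum>u\<in>V. \<Sum>v\<in>V. \<Sum>w\<in>V. adj E u w * adj E v w) =
    2 * real (card E) + 6 * real (card (triangles V E)) +
    (\<Sum>u\<in>V. \<Sum>v\<in>V. \<Sum>w\<in>V. coadj E u v * adj E u w * adj E v w)"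
proof -
  have fin: "finite V" using assms by (simp add: simple_graph_def)
  have "adj E u w * adj E v w = (if u = v then adj E u w else 0) +
      adj E u v * adj E u w * adj E v w + coadj E u v * adj E u w * adj E v w" for u v w
    using assms by (auto simp: adj_def coadj_def simple_graph_def nsets_def)
  then have "(\<Sum>u\<in>V. \<Sum>v\<in>V. \<Sum>w\<in>V. adj E u w * adj E v w) =
      (\<Sum>u\<in>V. \<Sum>v\<in>V. \<Sum>w\<in>V. (if u = v then adj E u w else 0) +
        adj E u v * adj E u w * adj E v w + coadj E u v * adj E u w * adj E v w)"
    by (intro sum.cong refl)
  also have "\<dots> = (\<Sum>u\<in>V. \<Sum>v\<in>V. \<Sum>w\<in>V. if u = v then adj E u w else 0) +
      (\<Sum>u\<in>V. \<Sum>v\<in>V. \<Sum>w\<in>V. adj E u v * adj E u w * adj E v w) +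
      (\<Sum>u\<in>V. \<Sum>v\<in>V. \<Sum>w\<in>V. coadj E u v * adj E u w * adj E v w)"
    by (simp only: sum.distrib)
  also have "(\<Sum>u\<in>V. \<Sum>v\<in>V. \<Sum>w\<in>V. if u = v then adj E u w else 0) = (\<Sum>u\<in>V. \<Sum>w\<in>V. adj E u w)"
  proof (rule sum.cong[OF refl])
    fix u assume "u \<in> V"
    have "(\<Sum>v\<in>V. \<Sum>w\<in>V. if u = v then adj E u w else 0) =
        (\<Sum>v\<in>V. if u = v then (\<Sum>w\<in>V. adj E u w) else 0)"
      by (intro sum.cong) auto
    then show "(\<Sum>v\<in>V. \<Sum>w\<in>V. if u = v then adj E u w else 0) = (\<Sum>w\<in>V. adj E u w)"
      using fin \<open>u \<in> V\<close> by simp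
  qed
  finally show ?thesis by (simp add: sum_adj[OF assms] sum_triangles[OF assms])
qed

text \<open>The number of walks of length two is squeezed between the Cauchy-Schwarz lower bound and
  the estimate of its induced part by the clique number. This is the first bound with denominators
  cleared.\<close>

lemma triangles_ge_degree_bound:
  assumes "simple_graph V E" "C4_free V E"
  defines "n \<equiv> real (card V)" and "m \<equiv> real (card E)"
  shows "(2 * m)\<^sup>2 \<le> n * (2 * m + 6 * real (card (triangles V E)) +
    real (clique_number V E) * (n * (n - 1) - 2 * m))"
proof -
  have "(2 * m)\<^sup>2 \<le> n * (\<Sum>u\<in>V. \<Sum>v\<in>V. \<Sum>w\<in>V. adj E u w * adj E v w)"
    unfolding n_def m_def by (rule sum_paths_ge[OF assms(1)])
  also have "\<dots> \<le> n * (2 * m + 6 * real (card (triangles V E)) +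
      real (clique_number V E) * (n * (n - 1) - 2 * m))"
    using sum_induced_paths_le[OF assms(1,2)]
    by (intro mult_left_mono) (simp_all add: sum_paths_eq[OF assms(1)] sum_coadj[OF assms(1)] n_def m_def)
  finally show ?thesis .
qed

section \<open>Non-edges inside triples and the second bound\<close>

lemma sum_distinct_third:
  assumes "finite V" "u \<in> V" "v \<in> V"
  shows "(\<Sum>w\<in>V. of_bool (u \<noteq> v \<and> u \<noteq> w \<and> v \<noteq> w) :: real) = of_bool (u \<noteq> v) * (real (card V) - 2)"
proof (cases "u = v")
  case False
  have "V \<inter> {w. u \<noteq> v \<and> u \<noteq> w \<and> v \<noteq> w} = V - {u, v}" using False by auto
  moreover have "card {u, v} \<le> card V" using assms by (intro card_mono) auto
  ultimately show ?thesis
    using assms False by (simp add: sum_of_bool_eq card_Diff_subset of_nat_diff)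
qed simp

text \<open>A non-adjacent pair extends to a triple of distinct vertices by any of the remaining n -
  2 vertices.\<close>

lemma sum_coadj_triples:
  assumes "finite V"
  shows "(\<Sum>u\<in>V. \<Sum>v\<in>V. \<Sum>w\<in>V. of_bool (u \<noteq> v \<and> u \<noteq> w \<and> v \<noteq> w) * coadj E u v) =
    (real (card V) - 2) * (\<Sum>u\<in>V. \<Sum>v\<in>V. coadj E u v)"
proof -
  have "(\<Sum>w\<in>V. of_bool (u \<noteq> v \<and> u \<noteq> w \<and> v \<noteq> w) * coadj E u v) = (real (card V) - 2) * coadj E u v"
    if "u \<in> V" "v \<in> V" for u v
    unfolding sum_distrib_right[symmetric] sum_distinct_third[OF assms that]
    by (auto simp: coadj_def)
  then show ?thesis by (simp add: sum_distrib_left)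
qed

lemma triangles_ge_coadj_bound:
  assumes "simple_graph V E" "C4_free V E"
  defines "n \<equiv> real (card V)" and "m \<equiv> real (card E)"
  shows "2 * (n * (n - 1) * (n - 2) - 6 * real (card (triangles V E))) \<le>
    3 * (n * (n - 1) - 2 * m) * (n - 2 + real (clique_number V E))"
proof -
  have fin: "finite V" using assms by (simp add: simple_graph_def)
  define s where "s u v w = (of_bool (u \<noteq> v \<and> u \<noteq> w \<and> v \<noteq> w) :: real)" for u v w :: 'a
  define S where "S f = (\<Sum>u\<in>V. \<Sum>v\<in>V. \<Sum>w\<in>V. f u v w)" for f :: "'a \<Rightarrow> 'a \<Rightarrow> 'a \<Rightarrow> real"
  \<comment> \<open>\<open>N\<close> records a non-edge in the first two places, and
    \<open>P\<close> an induced path whose middle vertex is in the third place. The argument orders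
    (u, v, w), (u, w, v) and (v, w, u) run over the three choices of the singled-out vertex.\<close>
  define N where "N u v w = s u v w * coadj E u v" for u v w
  define P where "P u v w = coadj E u v * adj E u w * adj E v w" for u v w
  \<comment> \<open>Sums over all ordered triples are invariant under permuting the places, so the
    three argument orders contribute equally; hence the factor 3 below.\<close>
  have swap23: "S (\<lambda>u v w. f u w v) = S f" for f
    unfolding S_def by (intro sum.cong refl sum.swap)
  have swap12: "S (\<lambda>u v w. f v u w) = S f" for f
    unfolding S_def by (rule sum.swap)
  have rot: "S (\<lambda>u v w. f v w u) = S f" for f
  proof -
    have "S (\<lambda>u v w. f v w u) = S (\<lambda>u v w. f u w v)" by (rule swap12[of "\<lambda>u v w. f u w v"])
    then show ?thesis using swap23[of f] by simp
  qed
  have add: "S (\<lambda>u v w. f u v w + g u v w) = S f + S g" for f g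
    by (simp add: S_def sum.distrib)
  \<comment> \<open>For distinct vertices with exactly one non-edge, the right side is 1 from
    \<open>N\<close> plus 1 from \<open>P\<close>; with two or three non-edges, \<open>N\<close>
    alone gives at least 2. In all other cases the left side is 0 and the right side is
    nonnegative.\<close>
  have "2 * (s u v w - adj E u v * adj E u w * adj E v w) \<le>
      ((N u v w + N u w v) + N v w u) + ((P u v w + P u w v) + P v w u)" for u v w
  proof -
    have comm: "adj E v u = adj E u v" "adj E w u = adj E u w" "adj E w v = adj E v w"
      by (rule adj_commute)+
    have "{x} \<notin> E" for x using assms(1) by (auto simp: simple_graph_def nsets_def)
    then show ?thesis
      unfolding N_def P_def s_def comm unfolding adj_def coadj_def
      by (cases "u = v"; cases "u = w"; cases "v = w";
          cases "{u, v} \<in> E"; cases "{u, w} \<in> E"; cases "{v, w} \<in> E"; simp)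
  qed
  then have "S (\<lambda>u v w. 2 * (s u v w - adj E u v * adj E u w * adj E v w)) \<le>
      S (\<lambda>u v w. ((N u v w + N u w v) + N v w u) + ((P u v w + P u w v) + P v w u))"
    unfolding S_def by (intro sum_mono)
  also have "\<dots> = 3 * S N + 3 * S P"
    by (simp add: add swap23[of N] swap23[of P] rot[of N] rot[of P])
  also have "S N = (n - 2) * (n * (n - 1) - 2 * m)"
    using sum_coadj_triples[OF fin, of E] sum_coadj[OF assms(1)]
    by (simp add: S_def N_def s_def n_def m_def)
  also have "S P \<le> real (clique_number V E) * (n * (n - 1) - 2 * m)"
    using sum_induced_paths_le[OF assms(1,2)] sum_coadj[OF assms(1)]
    by (simp add: S_def P_def n_def m_def)
  \<comment> \<open>The remaining steps of the calculation rewrite its left side, turning it into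
    the number of ordered triples of distinct vertices minus the ordered triangles, doubled.\<close>
  also have "S (\<lambda>u v w. 2 * (s u v w - adj E u v * adj E u w * adj E v w)) =
      2 * (S s - 6 * real (card (triangles V E)))"
    unfolding sum_triangles[OF assms(1), symmetric] S_def
    by (simp only: sum_distrib_left[symmetric] sum_subtractf)
  also have "S s = (\<Sum>u\<in>V. \<Sum>v\<in>V. of_bool (u \<noteq> v) * (n - 2))"
    unfolding S_def s_def n_def by (intro sum.cong refl sum_distinct_third fin)
  also have "\<dots> = n * (n - 1) * (n - 2)"
    by (simp only: sum_distrib_right[symmetric])
      (simp add: sum_distinct_right[OF fin] n_def del: sum_of_bool_eq)
  finally show ?thesis by (simp add: algebra_simps)
qed

section \<open>Passage from counts to densities\<close>

lemma real_choose_2: "real (n choose 2) = real n * (real n - 1) / 2"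
  by (simp add: binomial_gbinomial gbinomial_prod_rev numeral_2_eq_2)

lemma real_choose_3: "real (n choose 3) = real n * (real n - 1) * (real n - 2) / 6"
  by (simp add: binomial_gbinomial gbinomial_prod_rev numeral_3_eq_3)

theorem theorem1:
  fixes V :: "'a set" and E :: "'a set set" and n :: nat and \<epsilon> \<tau> \<kappa> :: real
  assumes "simple_graph V E"
    and "card V = n" and "n \<ge> 3"
    and "\<epsilon> = edge_density V E"
    and "\<tau> = triangle_density V E"
    and "\<kappa> = clique_density V E"
    and "C4_free V E"
  shows "\<tau> \<ge> max (\<epsilon>\<^sup>2 - (1 - \<epsilon>) * (\<kappa> * real n + \<epsilon>) / (real n - 2))
                 (1 - 3 / 2 * (1 - \<epsilon>) * (1 + \<kappa> * real n / (real n - 2)))"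
proof -
  define x where "x = real n"
  define m where "m = real (card E)"
  define t where "t = real (card (triangles V E))"
  define k where "k = real (clique_number V E)"
  have x: "x \<ge> 3" using assms(3) by (simp add: x_def)
  have k: "\<kappa> * real n = k"
    using assms(2,3,6) by (simp add: clique_density_def k_def)
  have "\<epsilon> = m / (x * (x - 1) / 2)"
    using assms(2,4) by (simp add: edge_density_def m_def x_def real_choose_2)
  then have m: "2 * m = \<epsilon> * (x * (x - 1))"
    using x by (simp add: field_simps)
  have "\<tau> = t / (x * (x - 1) * (x - 2) / 6)"
    using assms(2,5) by (simp add: triangle_density_def t_def x_def real_choose_3)
  moreover have "x * (x - 1) * (x - 2) \<noteq> 0"
    using x by simp
  ultimately have t: "6 * t = \<tau> * (x * (x - 1) * (x - 2))"
    by simp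
  have b1: "(2 * m)\<^sup>2 \<le> x * (2 * m + 6 * t + k * (x * (x - 1) - 2 * m))"
    using triangles_ge_degree_bound[OF assms(1,7)] assms(2) by (simp add: x_def m_def t_def k_def)
  have b2: "2 * (x * (x - 1) * (x - 2) - 6 * t) \<le> 3 * (x * (x - 1) - 2 * m) * (x - 2 + k)"
    using triangles_ge_coadj_bound[OF assms(1,7)] assms(2) by (simp add: x_def m_def t_def k_def)
  \<comment> \<open>After substituting the densities, both sides of \<open>b1\<close> share the
    factor \<open>x\<^sup>2 * (x - 1)\<close>, which is positive as x \<ge> 3 and can be
    cancelled.\<close>
  have "(x\<^sup>2 * (x - 1)) * (\<epsilon>\<^sup>2 * (x - 1)) \<le> (x\<^sup>2 * (x - 1)) * (\<epsilon> + \<tau> * (x - 2) + k * (1 - \<epsilon>))"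
    using b1 unfolding m t by (simp add: power2_eq_square algebra_simps)
  then have "\<epsilon>\<^sup>2 * (x - 1) \<le> \<epsilon> + \<tau> * (x - 2) + k * (1 - \<epsilon>)"
    by (rule mult_left_le_imp_le) (use x in simp)
  \<comment> \<open>Splitting x - 1 as (x - 2) + 1 leaves \<epsilon> -
    \<open>\<epsilon>\<^sup>2\<close> + k (1 - \<epsilon>) = (1 - \<epsilon>) (k + \<epsilon>) on
    the right; then x - 2 > 0 is divided out.\<close>
  then have c1: "\<epsilon>\<^sup>2 - (1 - \<epsilon>) * (k + \<epsilon>) / (x - 2) \<le> \<tau>"
    using x by (simp add: field_simps power2_eq_square)
  \<comment> \<open>Here 1 - \<tau> is the density of triples that are not triangles, and the common
    positive factor of \<open>b2\<close> is x (x - 1).\<close>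
  have "(x * (x - 1)) * (2 * (x - 2) * (1 - \<tau>)) \<le> (x * (x - 1)) * (3 * (1 - \<epsilon>) * (x - 2 + k))"
    using b2 unfolding m t by (simp add: algebra_simps)
  then have "2 * (x - 2) * (1 - \<tau>) \<le> 3 * (1 - \<epsilon>) * (x - 2 + k)"
    by (rule mult_left_le_imp_le) (use x in simp)
  then have c2: "1 - 3 / 2 * (1 - \<epsilon>) * (1 + k / (x - 2)) \<le> \<tau>"
    using x by (simp add: field_simps)
  show ?thesis
    unfolding k using c1 c2 by (simp add: x_def)
qed

end
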